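(* Let $X$ be a real normed vector space, $K\subset X$ a non-zero wedge and let $\mathcal{A}$ be a nonempty set of homogeneous and bounded maps $f:K\to K$. Then $\overline{r}_*(\mathcal{A})=\hat r_*(\mathcal{A})$, that is, the generalized spectral subradius and the joint spectral subradius of $\mathcal{A}$ are equal.
   Context: A wedge is a convex set $K\subseteq X$ with $\lambda K\subseteq K$ for all real $\lambda>0$. A map $f:K\to K$ is homogeneous if $f(cx)=cf(x)$ for all $c>0$, $x\in K$; its norm is $\|f\|:=\sup\{\|f(x)\| : x\in K,\|x\|=1\}$, and $f$ is bounded if $\|f\|<\infty$. For homogeneous bounded $f:K\to K$, $r(f):=\lim_{n\to\infty}\|f^n\|^{1/n}=\inf_{n>0}\|f^n\|^{1/n}$. For $m\in\mathbb{N}$ ($m\ge1$), $\mathcal{A}^m:=\{f_1\circ\cdots\circ f_m : f_i\in\mathcal{A}\}$, $\beta_m:=\inf_{f\in\mathcal{A}^m}\|f\|$ and $\gamma_m:=\inf_{f\in\mathcal{A}^m}r(f)$. The joint spectral subradius is $\hat r_*(\mathcal{A}):=\inf_{m\in\mathbb{N}}\beta_m^{1/m}$ and the generalized spectral subradius is $\overline{r}_*(\mathcal{A}):=\inf_{m\in\mathbb{N}}\gamma_m^{1/m}$. *)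

theory Defs
  imports "HOL-Analysis.Analysis"
begin

(* Not the library's cone: only strictly positive scalars are required, so 0 need not lie in K. *)
definition wedge :: "'a::real_normed_vector set \<Rightarrow> bool" where
  "wedge K \<longleftrightarrow> convex K \<and> (\<forall>c>0. \<forall>x\<in>K. c *\<^sub>R x \<in> K)"

(* A map f : K -> K is a total function sending K into K; no notion below depends
   on its values outside K. *)
definition homogeneous_on :: "'a::real_normed_vector set \<Rightarrow> ('a \<Rightarrow> 'a) \<Rightarrow> bool" where
  "homogeneous_on K f \<longleftrightarrow> (\<forall>c>0. \<forall>x\<in>K. f (c *\<^sub>R x) = c *\<^sub>R f x)"

definition wedge_norm_set :: "'a::real_normed_vector set \<Rightarrow> ('a \<Rightarrow> 'a) \<Rightarrow> real set" where
  "wedge_norm_set K f = {norm (f x) |x. x \<in> K \<and> norm x = 1}"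

(* The supremum is finite iff the set is bounded above; the real-valued wedge_norm is
   meaningful only for such f (and K containing a unit vector). *)
definition bounded_on_wedge :: "'a::real_normed_vector set \<Rightarrow> ('a \<Rightarrow> 'a) \<Rightarrow> bool" where
  "bounded_on_wedge K f \<longleftrightarrow> bdd_above (wedge_norm_set K f)"

definition wedge_norm :: "'a::real_normed_vector set \<Rightarrow> ('a \<Rightarrow> 'a) \<Rightarrow> real" where
  "wedge_norm K f = Sup (wedge_norm_set K f)"

definition spectral_radius_on :: "'a::real_normed_vector set \<Rightarrow> ('a \<Rightarrow> 'a) \<Rightarrow> real" where
  "spectral_radius_on K f = lim (\<lambda>n. root n (wedge_norm K (f ^^ n)))"

definition compositions :: "('a \<Rightarrow> 'a) set \<Rightarrow> nat \<Rightarrow> ('a \<Rightarrow> 'a) set" where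
  "compositions \<A> m = {foldr (\<circ>) fs id |fs. length fs = m \<and> set fs \<subseteq> \<A>}"

definition beta :: "'a::real_normed_vector set \<Rightarrow> ('a \<Rightarrow> 'a) set \<Rightarrow> nat \<Rightarrow> real" where
  "beta K \<A> m = (INF f\<in>compositions \<A> m. wedge_norm K f)"

definition gamma :: "'a::real_normed_vector set \<Rightarrow> ('a \<Rightarrow> 'a) set \<Rightarrow> nat \<Rightarrow> real" where
  "gamma K \<A> m = (INF f\<in>compositions \<A> m. spectral_radius_on K f)"

definition joint_spectral_subradius ::
    "'a::real_normed_vector set \<Rightarrow> ('a \<Rightarrow> 'a) set \<Rightarrow> real" where
  "joint_spectral_subradius K \<A> = (INF m\<in>{1..}. root m (beta K \<A> m))"

definition generalized_spectral_subradius ::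
    "'a::real_normed_vector set \<Rightarrow> ('a \<Rightarrow> 'a) set \<Rightarrow> real" where
  "generalized_spectral_subradius K \<A> = (INF m\<in>{1..}. root m (gamma K \<A> m))"

end

theory Submission
  imports Defs
begin

text \<open>
  Both inequalities compare a composition \<open>f\<close> of \<open>m\<close> maps with its iterates.  The norm on maps of the
  wedge is submultiplicative, so Fekete's lemma identifies the spectral radius of \<open>f\<close> both as the
  limit and as the infimum of \<open>\<parallel>f\<^sup>n\<parallel>\<^bsup>1/n\<^esup>\<close>.

  Being an infimum, it is at most \<open>\<parallel>f\<parallel>\<close>, whence \<open>\<gamma>\<^sub>m \<le> \<beta>\<^sub>m\<close> for every \<open>m\<close> and the generalized subradius is
  at most the joint one.  Being a limit, it inherits lower bounds: \<open>f\<^sup>n\<close> is a composition of \<open>n m\<close> maps,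
  so \<open>\<parallel>f\<^sup>n\<parallel> \<ge> \<beta>\<^bsub>n m\<^esub> \<ge> s\<^bsup>n m\<^esup>\<close> where \<open>s\<close> is the joint subradius.  Taking \<open>n\<close>-th roots and letting \<open>n\<close> grow
  shows that the spectral radius of \<open>f\<close> is at least \<open>s\<^sup>m\<close>, hence \<open>\<gamma>\<^sub>m \<ge> s\<^sup>m\<close>.
\<close>

section \<open>Submultiplicative sequences\<close>

lemma submultiplicative_iterate:
  fixes a :: "nat \<Rightarrow> real"
  assumes nonneg: "\<And>n. 0 \<le> a n" and submult: "\<And>m n. a (m + n) \<le> a m * a n"
  shows "a (k * q + r) \<le> a k ^ q * a r"
proof (induction q)
  case (Suc q)
  have "a (k * Suc q + r) = a (k + (k * q + r))"
    by (simp add: algebra_simps)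
  also have "\<dots> \<le> a k * a (k * q + r)"
    by (rule submult)
  also have "\<dots> \<le> a k * (a k ^ q * a r)"
    by (intro mult_left_mono Suc.IH nonneg)
  finally show ?case
    by (simp add: mult.assoc)
qed simp

text \<open>
  If \<open>root k (a k) < c\<close> for one \<open>k\<close>, then division of \<open>n\<close> by \<open>k\<close> bounds \<open>a n\<close> by \<open>c\<^sup>n\<close> times a constant
  that depends only on the remainder; the \<open>n\<close>-th root makes the constant disappear in the limit.
\<close>

lemma submultiplicative_root_eventually_less:
  fixes a :: "nat \<Rightarrow> real"
  assumes nonneg: "\<And>n. 0 \<le> a n" and submult: "\<And>m n. a (m + n) \<le> a m * a n"
    and k: "k \<ge> 1" and less: "root k (a k) < c" and "c < d"
  shows "\<forall>\<^sub>F n in sequentially. root n (a n) < d"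
proof -
  have c: "c > 0"
    using less real_root_ge_zero[OF nonneg[of k], of k] by linarith
  have ak: "a k \<le> c ^ k"
  proof -
    have "a k = root k (a k) ^ k"
      using k nonneg by simp
    also have "\<dots> \<le> c ^ k"
      using less by (intro power_mono real_root_ge_zero nonneg) simp
    finally show ?thesis .
  qed
  \<comment> \<open>The summand 1 makes the constant positive, so that its roots tend to 1.\<close>
  define M where "M = 1 + (\<Sum>r<k. a r / c ^ r)"
  have sum_nonneg: "(\<Sum>r<k. a r / c ^ r) \<ge> 0"
    using c nonneg by (intro sum_nonneg) auto
  have M: "M > 0"
    using sum_nonneg by (simp add: M_def)
  have bound: "a n \<le> M * c ^ n" for n
  proof -
    define q r where "q = n div k" and "r = n mod k"
    have n: "n = k * q + r" and r: "r < k"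
      using k by (auto simp: q_def r_def)
    have "a r / c ^ r \<le> (\<Sum>r<k. a r / c ^ r)"
      using r c nonneg by (intro member_le_sum) auto
    then have "a r / c ^ r \<le> M"
      by (simp add: M_def)
    then have ar: "a r \<le> M * c ^ r"
      using c by (simp add: divide_simps)
    have "a n \<le> a k ^ q * a r"
      unfolding n by (rule submultiplicative_iterate[OF nonneg submult])
    also have "\<dots> \<le> (c ^ k) ^ q * (M * c ^ r)"
      using ak ar nonneg c by (intro mult_mono power_mono) auto
    also have "\<dots> = M * c ^ n"
      by (simp add: n power_add power_mult)
    finally show ?thesis .
  qed
  have "(\<lambda>n. root n M * c) \<longlonglongrightarrow> 1 * c"
    by (intro tendsto_intros LIMSEQ_root_const M)
  then have "\<forall>\<^sub>F n in sequentially. root n M * c < d"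
    using \<open>c < d\<close> by (intro order_tendstoD) auto
  then show ?thesis
    using eventually_gt_at_top[of 0]
  proof eventually_elim
    case (elim n)
    have "root n (a n) \<le> root n (M * c ^ n)"
      using elim(2) bound by simp
    also have "\<dots> = root n M * c"
      using elim(2) c by (simp add: real_root_mult real_root_power_cancel)
    finally show ?case
      using elim(1) by simp
  qed
qed

text \<open>
  This is Fekete's lemma in multiplicative form.  Working with roots instead of logarithms covers
  sequences that vanish somewhere.
\<close>

lemma submultiplicative_root_tendsto_INF:
  fixes a :: "nat \<Rightarrow> real"
  assumes nonneg: "\<And>n. 0 \<le> a n" and submult: "\<And>m n. a (m + n) \<le> a m * a n"
  shows "(\<lambda>n. root n (a n)) \<longlonglongrightarrow> (INF n\<in>{1..}. root n (a n))"
proof (rule order_tendstoI)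
  let ?L = "INF n\<in>{1..}. root n (a n)"
  have bdd: "bdd_below ((\<lambda>n. root n (a n)) ` {1..})"
    using nonneg by (intro bdd_belowI2[of _ 0]) auto
  fix d
  {
    assume "d < ?L"
    show "\<forall>\<^sub>F n in sequentially. d < root n (a n)"
      using eventually_ge_at_top[of 1]
    proof eventually_elim
      case (elim n)
      then have "?L \<le> root n (a n)"
        by (intro cINF_lower bdd) auto
      then show ?case
        using \<open>d < ?L\<close> by simp
    qed
  next
    assume "?L < d"
    then obtain c where "?L < c" "c < d"
      using dense by blast
    then obtain k where "k \<in> {1..}" "root k (a k) < c"
      using cINF_less_iff[OF _ bdd, of c] by auto
    then show "\<forall>\<^sub>F n in sequentially. root n (a n) < d"
      using \<open>c < d\<close> by (intro submultiplicative_root_eventually_less[OF nonneg submult]) auto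
  }
qed

section \<open>Bounded homogeneous maps of a wedge\<close>

definition bounded_homogeneous_map :: "'a::real_normed_vector set \<Rightarrow> ('a \<Rightarrow> 'a) \<Rightarrow> bool" where
  "bounded_homogeneous_map K f \<longleftrightarrow> f \<in> K \<rightarrow> K \<and> homogeneous_on K f \<and> bounded_on_wedge K f"

lemma wedge_contains_unit_vector:
  assumes "wedge K" and "\<exists>x\<in>K. x \<noteq> 0"
  shows "\<exists>u\<in>K. norm u = 1"
proof -
  obtain x where x: "x \<in> K" "x \<noteq> 0"
    using assms(2) by blast
  then have "(1 / norm x) *\<^sub>R x \<in> K"
    using assms(1) by (simp add: wedge_def)
  moreover have "norm ((1 / norm x) *\<^sub>R x) = 1"
    using x by simp
  ultimately show ?thesis
    by blast
qed

lemma homogeneous_on_zero: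
  assumes "homogeneous_on K f" and "0 \<in> K"
  shows "f 0 = 0"
proof -
  have "f ((2::real) *\<^sub>R 0) = (2::real) *\<^sub>R f 0"
    using assms unfolding homogeneous_on_def by (meson zero_less_numeral)
  then show ?thesis
    by (simp add: scaleR_2)
qed

text \<open>
  The supremum over unit vectors controls all of \<open>K\<close> by homogeneity; the vector 0, which cannot be
  normalized, is fixed by every homogeneous map.
\<close>

lemma norm_le_wedge_norm_mult:
  assumes "wedge K" and "homogeneous_on K f" and "bounded_on_wedge K f" and "x \<in> K"
  shows "norm (f x) \<le> wedge_norm K f * norm x"
proof (cases "x = 0")
  case True
  then show ?thesis
    using homogeneous_on_zero[OF assms(2)] assms(4) by simp
next
  case False
  let ?u = "(1 / norm x) *\<^sub>R x"
  have u: "?u \<in> K" "norm ?u = 1"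
    using assms False by (auto simp: wedge_def)
  have "norm (f ?u) \<le> wedge_norm K f"
    unfolding wedge_norm_def
    using u assms(3) by (intro cSup_upper) (auto simp: wedge_norm_set_def bounded_on_wedge_def)
  moreover have "f ?u = (1 / norm x) *\<^sub>R f x"
    using assms False by (auto simp: homogeneous_on_def)
  ultimately show ?thesis
    using False by (simp add: divide_simps)
qed

lemma wedge_norm_nonneg:
  assumes "\<exists>u\<in>K. norm u = 1" and "bounded_on_wedge K f"
  shows "0 \<le> wedge_norm K f"
proof -
  obtain u where u: "u \<in> K" "norm u = 1"
    using assms(1) by blast
  have "0 \<le> norm (f u)"
    by simp
  also have "\<dots> \<le> wedge_norm K f"
    unfolding wedge_norm_def
    using u assms(2) by (intro cSup_upper) (auto simp: wedge_norm_set_def bounded_on_wedge_def)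
  finally show ?thesis .
qed

lemma wedge_norm_leI:
  assumes "\<exists>u\<in>K. norm u = 1" and "\<And>x. x \<in> K \<Longrightarrow> norm x = 1 \<Longrightarrow> norm (f x) \<le> C"
  shows "wedge_norm K f \<le> C"
  unfolding wedge_norm_def
  using assms by (intro cSup_least) (auto simp: wedge_norm_set_def)

context
  fixes K :: "'a::real_normed_vector set"
  assumes wedge: "wedge K" and unit_vector: "\<exists>u\<in>K. norm u = 1"
begin

lemma norm_comp_le:
  assumes f: "bounded_homogeneous_map K f" and g: "bounded_homogeneous_map K g"
    and x: "x \<in> K" "norm x = 1"
  shows "norm ((f \<circ> g) x) \<le> wedge_norm K f * wedge_norm K g"
proof -
  have "g x \<in> K"
    using g x by (auto simp: bounded_homogeneous_map_def)
  then have "norm (f (g x)) \<le> wedge_norm K f * norm (g x)"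
    using f by (intro norm_le_wedge_norm_mult wedge) (auto simp: bounded_homogeneous_map_def)
  also have "\<dots> \<le> wedge_norm K f * wedge_norm K g"
    using norm_le_wedge_norm_mult[OF wedge _ _ x(1), of g] f g x(2)
    by (intro mult_left_mono wedge_norm_nonneg unit_vector)
      (auto simp: bounded_homogeneous_map_def)
  finally show ?thesis
    by simp
qed

lemma wedge_norm_comp_le:
  assumes "bounded_homogeneous_map K f" and "bounded_homogeneous_map K g"
  shows "wedge_norm K (f \<circ> g) \<le> wedge_norm K f * wedge_norm K g"
  using assms by (intro wedge_norm_leI unit_vector norm_comp_le)

lemma bounded_homogeneous_map_comp:
  assumes f: "bounded_homogeneous_map K f" and g: "bounded_homogeneous_map K g"
  shows "bounded_homogeneous_map K (f \<circ> g)"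
proof -
  have "f \<circ> g \<in> K \<rightarrow> K"
    using f g by (auto simp: bounded_homogeneous_map_def)
  moreover have "homogeneous_on K (f \<circ> g)"
    using f g by (auto simp: bounded_homogeneous_map_def homogeneous_on_def Pi_iff)
  moreover have "bounded_on_wedge K (f \<circ> g)"
    unfolding bounded_on_wedge_def wedge_norm_set_def
    using norm_comp_le[OF f g] by (auto intro!: bdd_aboveI)
  ultimately show ?thesis
    by (simp add: bounded_homogeneous_map_def)
qed

lemma bounded_homogeneous_map_id: "bounded_homogeneous_map K id"
  by (auto simp: bounded_homogeneous_map_def homogeneous_on_def bounded_on_wedge_def
      wedge_norm_set_def intro!: bdd_aboveI[of _ 1])

lemma bounded_homogeneous_map_funpow:
  assumes "bounded_homogeneous_map K f"
  shows "bounded_homogeneous_map K (f ^^ n)"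
proof (induction n)
  case 0
  then show ?case
    using bounded_homogeneous_map_id by (simp add: id_def)
next
  case (Suc n)
  then show ?case
    using bounded_homogeneous_map_comp[OF assms] by (simp only: funpow.simps)
qed

lemma spectral_radius_tendsto_INF:
  assumes f: "bounded_homogeneous_map K f"
  shows "(\<lambda>n. root n (wedge_norm K (f ^^ n))) \<longlonglongrightarrow> (INF n\<in>{1..}. root n (wedge_norm K (f ^^ n)))"
proof (rule submultiplicative_root_tendsto_INF)
  show "0 \<le> wedge_norm K (f ^^ n)" for n
    using bounded_homogeneous_map_funpow[OF f]
    by (intro wedge_norm_nonneg unit_vector) (simp add: bounded_homogeneous_map_def)
  show "wedge_norm K (f ^^ (m + n)) \<le> wedge_norm K (f ^^ m) * wedge_norm K (f ^^ n)" for m n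
    unfolding funpow_add using f
    by (intro wedge_norm_comp_le bounded_homogeneous_map_funpow)
qed

lemma spectral_radius_tendsto:
  assumes "bounded_homogeneous_map K f"
  shows "(\<lambda>n. root n (wedge_norm K (f ^^ n))) \<longlonglongrightarrow> spectral_radius_on K f"
  unfolding spectral_radius_on_def
  using spectral_radius_tendsto_INF[OF assms] by (simp add: limI)

lemma spectral_radius_ge:
  assumes "bounded_homogeneous_map K f" and "\<And>n. n \<ge> 1 \<Longrightarrow> c \<le> root n (wedge_norm K (f ^^ n))"
  shows "c \<le> spectral_radius_on K f"
  by (rule LIMSEQ_le_const[OF spectral_radius_tendsto[OF assms(1)]]) (use assms(2) in blast)

lemma spectral_radius_nonneg:
  assumes "bounded_homogeneous_map K f"
  shows "0 \<le> spectral_radius_on K f"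
  using assms bounded_homogeneous_map_funpow[OF assms]
  by (intro spectral_radius_ge real_root_ge_zero wedge_norm_nonneg unit_vector)
    (auto simp: bounded_homogeneous_map_def)

lemma spectral_radius_le_wedge_norm:
  assumes f: "bounded_homogeneous_map K f"
  shows "spectral_radius_on K f \<le> wedge_norm K f"
proof -
  have nonneg: "0 \<le> wedge_norm K (f ^^ n)" for n
    using bounded_homogeneous_map_funpow[OF f]
    by (intro wedge_norm_nonneg unit_vector) (simp add: bounded_homogeneous_map_def)
  have "spectral_radius_on K f = (INF n\<in>{1..}. root n (wedge_norm K (f ^^ n)))"
    using LIMSEQ_unique spectral_radius_tendsto spectral_radius_tendsto_INF f by blast
  also have "\<dots> \<le> root 1 (wedge_norm K (f ^^ 1))"
    using nonneg by (intro cINF_lower bdd_belowI2[of _ 0]) auto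
  finally show ?thesis
    by simp
qed

end

section \<open>Compositions of a given length\<close>

lemma compositions_comp:
  assumes "f \<in> compositions \<A> m" and "g \<in> compositions \<A> n"
  shows "f \<circ> g \<in> compositions \<A> (m + n)"
proof -
  obtain fs gs where *: "f = foldr (\<circ>) fs id" "length fs = m" "set fs \<subseteq> \<A>"
      "g = foldr (\<circ>) gs id" "length gs = n" "set gs \<subseteq> \<A>"
    using assms by (auto simp: compositions_def)
  have "foldr (\<circ>) fs h = foldr (\<circ>) fs id \<circ> h" for h
    by (induction fs) (auto simp: comp_assoc)
  then have "f \<circ> g = foldr (\<circ>) (fs @ gs) id"
    by (metis * foldr_append comp_apply)
  with * show ?thesis
    unfolding compositions_def by (intro CollectI exI[of _ "fs @ gs"]) auto
qed

lemma compositions_funpow: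
  assumes "f \<in> compositions \<A> m"
  shows "f ^^ n \<in> compositions \<A> (n * m)"
proof (induction n)
  case 0
  then show ?case
    by (auto simp: compositions_def id_def)
next
  case (Suc n)
  then show ?case
    using compositions_comp[OF assms Suc.IH] by (simp only: funpow.simps mult_Suc)
qed

lemma compositions_nonempty:
  assumes "\<A> \<noteq> {}"
  shows "compositions \<A> m \<noteq> {}"
proof -
  obtain f where "f \<in> \<A>"
    using assms by blast
  then have "foldr (\<circ>) (replicate m f) id \<in> compositions \<A> m"
    unfolding compositions_def by (intro CollectI exI[of _ "replicate m f"]) auto
  then show ?thesis
    by blast
qed

lemma bounded_homogeneous_map_compositions:
  assumes "wedge K" and "\<exists>u\<in>K. norm u = 1"
    and "\<And>f. f \<in> \<A> \<Longrightarrow> bounded_homogeneous_map K f" and "f \<in> compositions \<A> m"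
  shows "bounded_homogeneous_map K f"
proof -
  obtain fs where "f = foldr (\<circ>) fs id" and "set fs \<subseteq> \<A>"
    using assms(4) by (auto simp: compositions_def)
  moreover have "set fs \<subseteq> \<A> \<Longrightarrow> bounded_homogeneous_map K (foldr (\<circ>) fs id)"
    by (induction fs)
      (simp_all add: bounded_homogeneous_map_comp bounded_homogeneous_map_id assms(1-3))
  ultimately show ?thesis
    by simp
qed

section \<open>Equality of the two subradii\<close>

theorem theorem6p2:
  fixes K :: "'a::real_normed_vector set" and \<A> :: "('a \<Rightarrow> 'a) set"
  assumes "wedge K" and "\<exists>x\<in>K. x \<noteq> 0"
    and "\<A> \<noteq> {}"
    and "\<And>f. f \<in> \<A> \<Longrightarrow> f \<in> K \<rightarrow> K"
    and "\<And>f. f \<in> \<A> \<Longrightarrow> homogeneous_on K f"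
    and "\<And>f. f \<in> \<A> \<Longrightarrow> bounded_on_wedge K f"
  shows "generalized_spectral_subradius K \<A> = joint_spectral_subradius K \<A>"
proof -
  have unit: "\<exists>u\<in>K. norm u = 1"
    using assms(1,2) by (rule wedge_contains_unit_vector)
  have maps: "bounded_homogeneous_map K f" if "f \<in> compositions \<A> m" for f m
    using assms(4-6)
    by (intro bounded_homogeneous_map_compositions[OF assms(1) unit _ that])
      (auto simp: bounded_homogeneous_map_def)
  have nonempty: "compositions \<A> m \<noteq> {}" for m
    using assms(3) by (rule compositions_nonempty)
  have norm_nonneg: "0 \<le> wedge_norm K f" if "f \<in> compositions \<A> m" for f m
    using maps[OF that] by (intro wedge_norm_nonneg unit) (simp add: bounded_homogeneous_map_def)
  have radius_nonneg: "0 \<le> spectral_radius_on K f" if "f \<in> compositions \<A> m" for f m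
    using maps[OF that] by (rule spectral_radius_nonneg[OF assms(1) unit])
  have beta_nonneg: "0 \<le> beta K \<A> m" for m
    unfolding beta_def using nonempty norm_nonneg by (intro cINF_greatest) auto
  have gamma_nonneg: "0 \<le> gamma K \<A> m" for m
    unfolding gamma_def using nonempty radius_nonneg by (intro cINF_greatest) auto
  have gamma_le_beta: "gamma K \<A> m \<le> beta K \<A> m" for m
    unfolding gamma_def beta_def
  proof (rule cINF_mono)
    show "bdd_below (spectral_radius_on K ` compositions \<A> m)"
      using radius_nonneg by (intro bdd_belowI2[of _ 0]) auto
    show "\<exists>g\<in>compositions \<A> m. spectral_radius_on K g \<le> wedge_norm K f"
      if "f \<in> compositions \<A> m" for f
      using that spectral_radius_le_wedge_norm[OF assms(1) unit maps[OF that]] by blast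
  qed (rule nonempty)
  define s where "s = joint_spectral_subradius K \<A>"
  have s_nonneg: "0 \<le> s"
    unfolding s_def joint_spectral_subradius_def
    using beta_nonneg by (intro cINF_greatest) auto
  have s_power_le: "s ^ m \<le> beta K \<A> m" if "m \<ge> 1" for m
  proof -
    have "s \<le> root m (beta K \<A> m)"
      unfolding s_def joint_spectral_subradius_def
      using that beta_nonneg by (intro cINF_lower bdd_belowI2[of _ 0]) auto
    then have "s ^ m \<le> root m (beta K \<A> m) ^ m"
      using s_nonneg by (rule power_mono)
    then show ?thesis
      using that beta_nonneg by simp
  qed
  have s_le_gamma: "s ^ m \<le> gamma K \<A> m" if "m \<ge> 1" for m
    unfolding gamma_def
  proof (rule cINF_greatest[OF nonempty])
    fix f assume f: "f \<in> compositions \<A> m"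
    show "s ^ m \<le> spectral_radius_on K f"
    proof (rule spectral_radius_ge[OF assms(1) unit maps[OF f]])
      fix n :: nat assume n: "n \<ge> 1"
      have "(s ^ m) ^ n = s ^ (n * m)"
        by (simp add: power_mult mult.commute)
      also have "\<dots> \<le> beta K \<A> (n * m)"
        using n that by (intro s_power_le) simp
      also have "\<dots> \<le> wedge_norm K (f ^^ n)"
        unfolding beta_def using norm_nonneg
        by (intro cINF_lower bdd_belowI2[of _ 0] compositions_funpow f) auto
      finally have "root n ((s ^ m) ^ n) \<le> root n (wedge_norm K (f ^^ n))"
        using n by simp
      then show "s ^ m \<le> root n (wedge_norm K (f ^^ n))"
        using n s_nonneg by (simp add: real_root_power_cancel)
    qed
  qed
  show ?thesis
  proof (rule antisym)
    show "generalized_spectral_subradius K \<A> \<le> joint_spectral_subradius K \<A>"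
      unfolding generalized_spectral_subradius_def joint_spectral_subradius_def
    proof (rule cINF_mono)
      show "bdd_below ((\<lambda>m. root m (gamma K \<A> m)) ` {1..})"
        using gamma_nonneg by (intro bdd_belowI2[of _ 0]) auto
      show "\<exists>n\<in>{1..}. root n (gamma K \<A> n) \<le> root m (beta K \<A> m)" if "m \<in> {1..}" for m
        using that gamma_le_beta by (intro bexI[of _ m]) auto
    qed simp
    have "s \<le> root m (gamma K \<A> m)" if "m \<ge> 1" for m
    proof -
      have "root m (s ^ m) \<le> root m (gamma K \<A> m)"
        using that s_le_gamma by simp
      then show ?thesis
        using that s_nonneg by (simp add: real_root_power_cancel)
    qed
    then show "joint_spectral_subradius K \<A> \<le> generalized_spectral_subradius K \<A>"
      unfolding s_def[symmetric] generalized_spectral_subradius_def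
      by (intro cINF_greatest) auto
  qed
qed

end
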